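(* Let $Y=g(X,\varepsilon)$, where $\varepsilon$ has CDF $F_\varepsilon$, and let $V$ be a control variable. Suppose $E[Y\mid X,V]=p(X)'q_0(V)$ for a known $J$-vector of functions $p(X)$ and an unknown $J$-vector of functional coefficients $q_0(V)$, and that the average structural function (ASF) satisfies $\mu(X)\equiv\int g(X,\varepsilon)\,dF_\varepsilon(\varepsilon)=p(X)'E[q_0(V)]$. Suppose also that $E[p(X)p(X)']$ is nonsingular. If $E[p(X)p(X)'\mid V]$ is singular with positive probability, then the ASF is not identified.
   Context: $J$ is finite; all expectations written are assumed to exist. ASF identification means: there is no measurable $\bar q$ (with $E[\bar q(V)]$ finite) that is observationally equivalent to $q_0$, i.e. $p(X)'\bar q(V)=p(X)'q_0(V)$ almost surely, and for which $p(X)'E[\bar q(V)]\neq p(X)'E[q_0(V)]$ with positive probability. "Not identified" is the negation. *)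

theory Defs
  imports "HOL-Probability.Probability"
begin

definition sigma_gen :: "'w measure \<Rightarrow> ('w \<Rightarrow> 'a) \<Rightarrow> 'a measure \<Rightarrow> 'w measure" where
  "sigma_gen M Z N = vimage_algebra (space M) Z N"

text \<open>\<open>Z\<close> takes values in \<open>N\<close>; the result is a version of \<open>E[f | Z]\<close>, as a random variable on \<open>M\<close>.\<close>

definition cond_expect :: "'w measure \<Rightarrow> ('w \<Rightarrow> real) \<Rightarrow> ('w \<Rightarrow> 'a) \<Rightarrow> 'a measure \<Rightarrow> 'w \<Rightarrow> real" where
  "cond_expect M f Z N = real_cond_exp M (sigma_gen M Z N) f"

text \<open>\<open>V\<close> is a control variable for \<open>Y = g(X, eps)\<close>: \<open>X\<close> and \<open>eps\<close> are independent
  conditional on \<open>V\<close>, i.e. \<open>P(X \<in> A, eps \<in> B | V) = P(X \<in> A | V) P(eps \<in> B | V)\<close> almost surely.\<close>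

definition control_variable ::
  "'w measure \<Rightarrow> ('w \<Rightarrow> 'x) \<Rightarrow> 'x measure \<Rightarrow> ('w \<Rightarrow> 'e) \<Rightarrow> 'e measure \<Rightarrow> ('w \<Rightarrow> 'v) \<Rightarrow> 'v measure \<Rightarrow> bool" where
  "control_variable M X MX eps ME V MV \<longleftrightarrow>
     (\<forall>A\<in>sets MX. \<forall>B\<in>sets ME. AE \<omega> in M.
        cond_expect M (indicator {w \<in> space M. X w \<in> A \<and> eps w \<in> B}) V MV \<omega> =
        cond_expect M (indicator {w \<in> space M. X w \<in> A}) V MV \<omega> *
        cond_expect M (indicator {w \<in> space M. eps w \<in> B}) V MV \<omega>)"

definition outer_prod :: "real ^ 'j \<Rightarrow> real ^ 'j \<Rightarrow> real ^ 'j ^ 'j" where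
  "outer_prod a b = (\<chi> i k. a $ i * b $ k)"

text \<open>Entrywise conditional expectation of a random matrix.\<close>

definition cond_expect_matrix ::
  "'w measure \<Rightarrow> ('w \<Rightarrow> real ^ 'n ^ 'm) \<Rightarrow> ('w \<Rightarrow> 'a) \<Rightarrow> 'a measure \<Rightarrow> 'w \<Rightarrow> real ^ 'n ^ 'm" where
  "cond_expect_matrix M A Z N \<omega> = (\<chi> i k. cond_expect M (\<lambda>w. A w $ i $ k) Z N \<omega>)"

text \<open>The average structural function \<open>\<mu>(x) = \<integral> g(x, e) dF(e)\<close>; integration against the CDF \<open>F\<close>
  of the (possibly vector-valued) disturbance is integration against its law.\<close>

definition asf :: "'w measure \<Rightarrow> ('x \<Rightarrow> 'e \<Rightarrow> real) \<Rightarrow> ('w \<Rightarrow> 'e::euclidean_space) \<Rightarrow> 'x \<Rightarrow> real" where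
  "asf M g eps x = (\<integral>e. g x e \<partial>distr M borel eps)"

definition observationally_equivalent ::
  "'w measure \<Rightarrow> ('w \<Rightarrow> 'x) \<Rightarrow> ('w \<Rightarrow> 'v) \<Rightarrow> ('x \<Rightarrow> real ^ 'j) \<Rightarrow>
   ('v \<Rightarrow> real ^ 'j) \<Rightarrow> ('v \<Rightarrow> real ^ 'j) \<Rightarrow> bool" where
  "observationally_equivalent M X V p q q0 \<longleftrightarrow>
     (AE \<omega> in M. p (X \<omega>) \<bullet> q (V \<omega>) = p (X \<omega>) \<bullet> q0 (V \<omega>))"

definition asf_identified ::
  "'w measure \<Rightarrow> ('w \<Rightarrow> 'x) \<Rightarrow> ('w \<Rightarrow> 'v) \<Rightarrow> 'v measure \<Rightarrow> ('x \<Rightarrow> real ^ 'j) \<Rightarrow>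
   ('v \<Rightarrow> real ^ 'j) \<Rightarrow> bool" where
  "asf_identified M X V MV p q0 \<longleftrightarrow>
     \<not> (\<exists>q. q \<in> borel_measurable MV \<and> integrable M (\<lambda>\<omega>. q (V \<omega>)) \<and>
           observationally_equivalent M X V p q q0 \<and>
           measure M {\<omega> \<in> space M.
             p (X \<omega>) \<bullet> (\<integral>w. q (V w) \<partial>M) \<noteq> p (X \<omega>) \<bullet> (\<integral>w. q0 (V w) \<partial>M)} > 0)"

end

theory Submission
  imports Defs
begin

text \<open>Let \<open>A(V)\<close> be the conditional second moment matrix of \<open>p(X)\<close> given \<open>V\<close>. If \<open>\<Delta>\<close> is bounded and
  measurable with \<open>A(v) \<Delta>(v) = 0\<close>, then \<open>E[(p(X)'\<Delta>(V))\<^sup>2] = E[\<Delta>(V)'A(V)\<Delta>(V)] = 0\<close>, so \<open>q\<^sub>0 + \<Delta>\<close> is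
  observationally equivalent to \<open>q\<^sub>0\<close>; it has a different ASF as soon as \<open>E[\<Delta>(V)] \<noteq> 0\<close>, because
  \<open>E[p(X)p(X)']\<close> is nonsingular. A suitable \<open>\<Delta>\<close> is a scalar multiple of the orthogonal projection
  of some unit vector \<open>e\<^sub>i\<close> onto the kernel of \<open>A(v)\<close>. That projection is Borel measurable in \<open>A\<close>
  because it is the limit of gradient descent for \<open>|A x|\<^sup>2\<close> started at \<open>e\<^sub>i\<close>, whose iterates
  depend continuously on \<open>A\<close>.\<close>

subsection \<open>Measurable projection onto the kernel of a matrix\<close>

lemma inner_funpow_commute:
  fixes T :: "'a::real_inner \<Rightarrow> 'a"
  assumes "\<And>x y. T x \<bullet> y = x \<bullet> T y"
  shows "(T ^^ m) x \<bullet> y = x \<bullet> (T ^^ m) y"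
  by (induction m arbitrary: x y) (simp_all add: assms funpow_swap1)

text \<open>By symmetry, the inner product of the iterates with exponents \<open>2 * m\<close> and
  \<open>2 * n\<close> is the squared norm of the iterate with exponent \<open>m + n\<close>.
  Squared distances are thus combinations of terms of one decreasing, hence convergent,
  sequence.\<close>

lemma Cauchy_even_funpow_symmetric_contraction:
  fixes T :: "'a::real_inner \<Rightarrow> 'a"
  assumes sym: "\<And>x y. T x \<bullet> y = x \<bullet> T y"
    and contr: "\<And>x. norm (T x) \<le> norm x"
  shows "Cauchy (\<lambda>n. (T ^^ (2 * n)) x)"
proof (rule metric_CauchyI)
  fix e :: real
  assume "e > 0"
  define a where "a n = (norm ((T ^^ n) x))\<^sup>2" for n
  have "decseq a"
    unfolding a_def by (intro decseq_SucI power_mono) (auto intro: contr)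
  then obtain L where L: "a \<longlonglongrightarrow> L" "\<And>n. L \<le> a n"
    using decseq_convergent[of a 0] by (auto simp: a_def)
  \<comment> \<open>The tolerance is chosen so that two upper bounds
    \<open>L + e\<^sup>2 / 2\<close> minus twice the lower bound \<open>L\<close> give exactly
    \<open>e\<^sup>2\<close>.\<close>
  then have "\<forall>\<^sub>F n in sequentially. a n < L + e\<^sup>2 / 2"
    using \<open>e > 0\<close> by (intro order_tendstoD) auto
  then obtain N where N: "\<And>n. n \<ge> N \<Longrightarrow> a n < L + e\<^sup>2 / 2"
    by (auto simp: eventually_sequentially)
  show "\<exists>N. \<forall>m\<ge>N. \<forall>n\<ge>N. dist ((T ^^ (2 * m)) x) ((T ^^ (2 * n)) x) < e"
  proof (intro exI allI impI)
    fix m n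
    assume mn: "m \<ge> N" "n \<ge> N"
    have "(T ^^ (2 * m)) x \<bullet> (T ^^ (2 * n)) x = (T ^^ (m + n)) x \<bullet> (T ^^ (m + n)) x"
    proof -
      have "(T ^^ (2 * m)) x \<bullet> (T ^^ (2 * n)) x = x \<bullet> (T ^^ (2 * m + 2 * n)) x"
        by (simp add: inner_funpow_commute[OF sym] funpow_add)
      also have "2 * m + 2 * n = (m + n) + (m + n)"
        by simp
      also have "x \<bullet> (T ^^ \<dots>) x = (T ^^ (m + n)) x \<bullet> (T ^^ (m + n)) x"
        unfolding inner_funpow_commute[OF sym] by (simp add: funpow_add)
      finally show ?thesis .
    qed
    then have "(dist ((T ^^ (2 * m)) x) ((T ^^ (2 * n)) x))\<^sup>2 = a (2 * m) + a (2 * n) - 2 * a (m + n)"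
      by (simp add: dist_norm a_def power2_norm_eq_inner inner_diff inner_commute)
    also have "\<dots> < e\<^sup>2"
      using N[of "2 * m"] N[of "2 * n"] L(2)[of "m + n"] mn by linarith
    finally show "dist ((T ^^ (2 * m)) x) ((T ^^ (2 * n)) x) < e"
      using \<open>e > 0\<close> by (auto intro: power2_less_imp_less)
  qed
qed

text \<open>A crude bound for the operator norm, chosen because its continuity in \<open>A\<close>
  is immediate.\<close>

definition entry_sum :: "real ^ 'n ^ 'm \<Rightarrow> real" where
  "entry_sum A = (\<Sum>i\<in>UNIV. \<Sum>j\<in>UNIV. \<bar>A $ i $ j\<bar>)"

lemma norm_vector_matrix_le: "norm (x v* A) \<le> entry_sum A * norm x"
  for A :: "real ^ 'n ^ 'm"
proof -
  have "norm (x v* A) \<le> onorm ((*v) (transpose A)) * norm x"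
    using onorm[OF matrix_vector_mul_bounded_linear, of "transpose A" x] by simp
  also have "onorm ((*v) (transpose A)) \<le> entry_sum A"
    using onorm_le_matrix_component_sum[of "transpose A"]
    unfolding entry_sum_def by (subst sum.swap) (simp add: transpose_def)
  finally show ?thesis
    by (simp add: mult_right_mono)
qed

text \<open>A gradient step for \<open>|A x|\<^sup>2 / 2\<close>; since \<open>entry_sum A\<close> bounds the norm of the transpose of \<open>A\<close>,
  the step size makes it a contraction.\<close>

definition descent_step :: "real ^ 'n ^ 'm \<Rightarrow> real ^ 'n \<Rightarrow> real ^ 'n" where
  "descent_step A x = x - (1 / (1 + (entry_sum A)\<^sup>2)) *\<^sub>R ((A *v x) v* A)"

lemma descent_step_symmetric: "descent_step A x \<bullet> y = x \<bullet> descent_step A y"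
  by (simp add: descent_step_def inner_diff dot_lmul_matrix inner_commute[of x] inner_commute[of "A *v y"])

text \<open>Expand the square: the cross term is \<open>-2 * s\<close> times
  \<open>(norm (A *v x))\<^sup>2\<close>, and the step size \<open>s\<close> lets the quadratic term
  cancel at most half of it. The surviving half measures the strict decrease off the kernel.\<close>

lemma norm_descent_step:
  "(norm (descent_step A x))\<^sup>2 + (1 / (1 + (entry_sum A)\<^sup>2)) * (norm (A *v x))\<^sup>2 \<le> (norm x)\<^sup>2"
proof -
  define s where "s = 1 / (1 + (entry_sum A)\<^sup>2)"
  define w where "w = (A *v x) v* A"
  have pos: "1 + (entry_sum A)\<^sup>2 > 0"
    by (simp add: add_pos_nonneg)
  have s: "s \<ge> 0" "s * (entry_sum A)\<^sup>2 \<le> 1"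
    using pos by (auto simp: s_def divide_simps)
  have xw: "x \<bullet> w = (norm (A *v x))\<^sup>2"
    by (simp add: w_def dot_lmul_matrix power2_norm_eq_inner inner_commute[of x])
  have "(norm w)\<^sup>2 \<le> (entry_sum A)\<^sup>2 * (norm (A *v x))\<^sup>2"
    using norm_vector_matrix_le[of "A *v x" A]
    by (metis norm_ge_zero power_mono power_mult_distrib w_def)
  then have "s * (norm w)\<^sup>2 \<le> (s * (entry_sum A)\<^sup>2) * (norm (A *v x))\<^sup>2"
    using s by (simp add: mult_left_mono mult.assoc)
  also have "\<dots> \<le> (norm (A *v x))\<^sup>2"
    using mult_right_mono[OF s(2), of "(norm (A *v x))\<^sup>2"] by simp
  finally have *: "s * (s * (norm w)\<^sup>2) \<le> s * (norm (A *v x))\<^sup>2"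
    using s by (simp add: mult_left_mono)
  have "(norm (x - s *\<^sub>R w))\<^sup>2 = (norm x)\<^sup>2 - 2 * s * (x \<bullet> w) + s * (s * (norm w)\<^sup>2)"
    by (simp add: power2_norm_eq_inner inner_diff inner_commute algebra_simps)
  with * xw show ?thesis
    unfolding descent_step_def s_def[symmetric] w_def[symmetric] by simp
qed

lemma norm_descent_step_le: "norm (descent_step A x) \<le> norm x"
proof -
  have "0 \<le> (1 / (1 + (entry_sum A)\<^sup>2)) * (norm (A *v x))\<^sup>2"
    by simp
  with norm_descent_step[of A x] have "(norm (descent_step A x))\<^sup>2 \<le> (norm x)\<^sup>2"
    by linarith
  then show ?thesis
    by (rule power2_le_imp_le) simp
qed

lemma descent_step_kernel: "A *v y = 0 \<Longrightarrow> descent_step A y = y"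
  by (simp add: descent_step_def vector_matrix_mult_def vec_eq_iff)

text \<open>Only even powers of the step are used because Cauchyness then follows from symmetry and
  contractivity alone.\<close>

definition kernel_projection :: "real ^ 'n ^ 'm \<Rightarrow> real ^ 'n \<Rightarrow> real ^ 'n" where
  "kernel_projection A x = lim (\<lambda>n. (descent_step A ^^ (2 * n)) x)"

lemma kernel_projection_LIMSEQ:
  "(\<lambda>n. (descent_step A ^^ (2 * n)) x) \<longlonglongrightarrow> kernel_projection A x"
  unfolding kernel_projection_def convergent_LIMSEQ_iff[symmetric] Cauchy_convergent_iff[symmetric]
  by (intro Cauchy_even_funpow_symmetric_contraction descent_step_symmetric norm_descent_step_le)

lemma norm_kernel_projection_le: "norm (kernel_projection A x) \<le> norm x"
proof -
  have "norm ((descent_step A ^^ n) x) \<le> norm x" for n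
    by (induction n) (auto intro: order_trans[OF norm_descent_step_le])
  then show ?thesis
    by (intro Lim_bounded[OF tendsto_norm[OF kernel_projection_LIMSEQ]]) auto
qed

lemma continuous_descent_step:
  "isCont (descent_step A) x"
  unfolding descent_step_def matrix_vector_mult_def vector_matrix_mult_def
  unfolding continuous_at by (intro tendsto_intros tendsto_vec_lambda)

text \<open>The limit is fixed by two steps. Since no step increases the norm, the first one
  preserves it, and the quantitative decrease then forces \<open>A *v ?z = 0\<close>.\<close>

lemma kernel_projection_in_kernel: "A *v kernel_projection A x = 0"
proof -
  let ?T = "descent_step A" and ?z = "kernel_projection A x"
  have "(\<lambda>n. ?T (?T ((?T ^^ (2 * n)) x))) \<longlonglongrightarrow> ?T (?T ?z)"
    by (intro isCont_tendsto_compose[OF continuous_descent_step] kernel_projection_LIMSEQ)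
  moreover have "(\<lambda>n. ?T (?T ((?T ^^ (2 * n)) x))) \<longlonglongrightarrow> ?z"
    using LIMSEQ_Suc[OF kernel_projection_LIMSEQ[of A x]] by simp
  ultimately have "?T (?T ?z) = ?z"
    by (rule LIMSEQ_unique)
  then have "norm ?z \<le> norm (?T ?z)"
    by (metis norm_descent_step_le)
  then have "(norm ?z)\<^sup>2 \<le> (norm (?T ?z))\<^sup>2"
    by (simp add: power_mono)
  with norm_descent_step[of A ?z] have "(1 / (1 + (entry_sum A)\<^sup>2)) * (norm (A *v ?z))\<^sup>2 \<le> 0"
    by linarith
  moreover have "1 + (entry_sum A)\<^sup>2 > 0"
    by (simp add: add_pos_nonneg)
  ultimately show ?thesis
    by (simp add: divide_le_0_iff)
qed

text \<open>Kernel vectors are fixed by the symmetric step, so the inner product with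
  \<open>y\<close> is constant along the iterates. As the limit lies in the kernel, it is the
  orthogonal projection.\<close>

lemma inner_kernel_projection:
  assumes "A *v y = 0"
  shows "kernel_projection A x \<bullet> y = x \<bullet> y"
proof -
  have "(descent_step A ^^ n) y = y" for n
    by (induction n) (simp_all add: descent_step_kernel[OF assms])
  then have "(descent_step A ^^ n) x \<bullet> y = x \<bullet> y" for n
    by (simp add: inner_funpow_commute descent_step_symmetric)
  then have "(\<lambda>n. (descent_step A ^^ (2 * n)) x \<bullet> y) \<longlonglongrightarrow> x \<bullet> y"
    by simp
  moreover have "(\<lambda>n. (descent_step A ^^ (2 * n)) x \<bullet> y) \<longlonglongrightarrow> kernel_projection A x \<bullet> y"
    by (intro tendsto_inner kernel_projection_LIMSEQ tendsto_const)
  ultimately show ?thesis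
    by (rule LIMSEQ_unique[symmetric])
qed

lemma borel_measurable_kernel_projection [measurable]:
  fixes x :: "real ^ 'n"
  shows "(\<lambda>A :: real ^ 'n ^ 'm. kernel_projection A x) \<in> borel_measurable borel"
proof (rule borel_measurable_LIMSEQ_metric)
  \<comment> \<open>The summand 1 keeps the step size continuous even at
    \<open>A = 0\<close>.\<close>
  have "1 + (entry_sum A)\<^sup>2 \<noteq> 0" for A :: "real ^ 'n ^ 'm"
    by (smt (verit) zero_le_power2)
  then have s: "continuous_on UNIV (\<lambda>A :: real ^ 'n ^ 'm. 1 / (1 + (entry_sum A)\<^sup>2))"
    unfolding entry_sum_def by (intro continuous_intros) auto
  have "continuous_on UNIV (\<lambda>A :: real ^ 'n ^ 'm. (descent_step A ^^ n) x)" for n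
  proof (induction n)
    case (Suc n)
    then have "continuous_on UNIV (\<lambda>A :: real ^ 'n ^ 'm. descent_step A ((descent_step A ^^ n) x))"
      unfolding descent_step_def[of _ "(descent_step _ ^^ n) x"]
        matrix_vector_mult_def vector_matrix_mult_def
      by (intro continuous_on_diff continuous_on_scaleR continuous_on_const s
        continuous_on_vec_lambda continuous_on_sum continuous_on_mult Suc.IH
        continuous_on_component continuous_on_id)
    then show ?case
      by simp
  qed simp
  then show "(\<lambda>A :: real ^ 'n ^ 'm. (descent_step A ^^ (2 * n)) x) \<in> borel_measurable borel" for n
    by (rule borel_measurable_continuous_onI)
qed (rule kernel_projection_LIMSEQ)

text \<open>Each coordinate of a kernel vector is its inner product with some projected unit vector,
  so the kernel is trivial.\<close>

lemma kernel_projection_axis_eq_0_imp_invertible: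
  fixes A :: "real ^ 'n ^ 'n"
  assumes "\<And>i. kernel_projection A (axis i 1) = 0"
  shows "invertible A"
proof -
  have "y = 0" if "A *v y = 0" for y
    using inner_kernel_projection[OF that, of "axis _ 1"] assms
    by (simp add: vec_eq_iff inner_axis')
  then show ?thesis
    by (simp add: invertible_left_inverse matrix_left_invertible_ker)
qed

subsection \<open>Factorization through the conditioning variable\<close>

text \<open>Indicators factor because the sets of the generated sigma-algebra are preimages under
  \<open>V\<close>; scaling, sums and suprema carry over to the factors.\<close>

lemma Doob_Dynkin_ennreal:
  fixes f :: "'a \<Rightarrow> ennreal"
  assumes V: "V \<in> \<Omega> \<rightarrow> space N" and f: "f \<in> borel_measurable (vimage_algebra \<Omega> V N)"
  shows "\<exists>h\<in>borel_measurable N. \<forall>x\<in>\<Omega>. f x = h (V x)"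
  using f
proof (induction rule: borel_measurable_induct)
  case (cong f g)
  then show ?case
    by (metis space_vimage_algebra)
next
  case (set A)
  then obtain B where "B \<in> sets N" "A = V -` B \<inter> \<Omega>"
    using V by (auto simp: sets_vimage_algebra2)
  then show ?case
    by (intro bexI[of _ "indicator B"]) (auto simp: indicator_def)
next
  case (mult u c)
  obtain h where [measurable]: "h \<in> borel_measurable N" and h: "\<forall>x\<in>\<Omega>. u x = h (V x)"
    using mult.IH by blast
  show ?case
    by (rule bexI[of _ "\<lambda>v. c * h v"]) (use h in simp, measurable)
next
  case (add u v)
  obtain h k where [measurable]: "h \<in> borel_measurable N" "k \<in> borel_measurable N"
    and hk: "\<forall>x\<in>\<Omega>. u x = h (V x)" "\<forall>x\<in>\<Omega>. v x = k (V x)"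
    using add.IH by blast
  show ?case
    by (rule bexI[of _ "\<lambda>y. k y + h y"]) (use hk in simp, measurable)
next
  case (seq U)
  obtain h where [measurable]: "\<And>i. h i \<in> borel_measurable N"
    and h: "\<And>i x. x \<in> \<Omega> \<Longrightarrow> U i x = h i (V x)"
  proof -
    have "\<forall>i. \<exists>h. h \<in> borel_measurable N \<and> (\<forall>x\<in>\<Omega>. U i x = h (V x))"
      using seq.IH by blast
    from choice[OF this] show ?thesis
      using that by blast
  qed
  show ?case
    by (rule bexI[of _ "\<lambda>y. SUP i. h i y"]) (use h in \<open>simp add: image_comp\<close>, measurable)
qed

lemma Doob_Dynkin_real:
  fixes f :: "'a \<Rightarrow> real"
  assumes V: "V \<in> \<Omega> \<rightarrow> space N" and f [measurable]: "f \<in> borel_measurable (vimage_algebra \<Omega> V N)"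
  shows "\<exists>h\<in>borel_measurable N. \<forall>x\<in>\<Omega>. f x = h (V x)"
proof -
  obtain h k where [measurable]: "h \<in> borel_measurable N" "k \<in> borel_measurable N"
    and hk: "\<forall>x\<in>\<Omega>. ennreal (f x) = h (V x)" "\<forall>x\<in>\<Omega>. ennreal (- f x) = k (V x)"
    using Doob_Dynkin_ennreal[OF V, of "\<lambda>x. ennreal (f x)"]
      Doob_Dynkin_ennreal[OF V, of "\<lambda>x. ennreal (- f x)"] by auto
  \<comment> \<open>\<open>ennreal\<close> sends negative reals to 0, so this is the splitting into
    positive and negative parts.\<close>
  have *: "f x = enn2real (ennreal (f x)) - enn2real (ennreal (- f x))" for x
    by (cases "f x \<ge> 0") (auto simp: ennreal_neg)
  show ?thesis
  proof (intro bexI ballI)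
    show "f x = enn2real (h (V x)) - enn2real (k (V x))" if "x \<in> \<Omega>" for x
      using *[of x] hk that by simp
  qed measurable
qed

subsection \<open>Conditional and unconditional second moment matrices\<close>

lemma borel_measurable_vec_lambda:
  fixes f :: "'i::finite \<Rightarrow> 'a \<Rightarrow> 'b::euclidean_space"
  assumes "\<And>i. f i \<in> borel_measurable M"
  shows "(\<lambda>x. \<chi> i. f i x) \<in> borel_measurable M"
proof (subst borel_measurable_euclidean_space, intro ballI)
  fix b :: "'b ^ 'i"
  assume "b \<in> Basis"
  then obtain i u where "b = axis i u"
    by (auto simp: Basis_vec_def)
  then show "(\<lambda>x. (\<chi> i. f i x) \<bullet> b) \<in> borel_measurable M"
    using assms[of i] by (simp add: inner_axis)
qed

lemma borel_measurable_vec_nth [measurable (raw)]: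
  fixes f :: "'a \<Rightarrow> 'b::real_normed_vector ^ 'i"
  assumes "f \<in> borel_measurable M"
  shows "(\<lambda>x. f x $ i) \<in> borel_measurable M"
  using assms
  by (rule borel_measurable_continuous_on[rotated]) (intro continuous_intros)

lemma vec_nth_integral:
  fixes f :: "'a \<Rightarrow> 'b::euclidean_space ^ 'i"
  assumes "integrable M f"
  shows "(\<integral>x. f x \<partial>M) $ i = (\<integral>x. f x $ i \<partial>M)"
  by (rule integral_bounded_linear[OF bounded_linear_vec_nth assms, symmetric])

lemma integrable_vec_nth:
  fixes f :: "'a \<Rightarrow> 'b::euclidean_space ^ 'i"
  assumes "integrable M f"
  shows "integrable M (\<lambda>x. f x $ i)"
  by (rule integrable_bounded_linear[OF bounded_linear_vec_nth assms])

context sigma_finite_subalgebra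
begin

text \<open>Expanding the square and pulling the \<open>F\<close>-measurable coordinates of
  \<open>D\<close> out of the conditional expectation turns the second moment of
  \<open>Z x \<bullet> D x\<close> into the mean of a quadratic form that vanishes. Boundedness of
  \<open>D\<close> keeps every product integrable.\<close>

lemma AE_inner_eq_0_of_cond_exp_kernel:
  fixes Z D :: "'a \<Rightarrow> real ^ 'j"
  assumes Z [measurable]: "Z \<in> borel_measurable M"
    and D [measurable]: "D \<in> borel_measurable F"
    and bound: "\<And>x. norm (D x) \<le> 1"
    and int: "\<And>i k. integrable M (\<lambda>x. Z x $ i * Z x $ k)"
    and kernel: "AE x in M. (\<chi> i k. real_cond_exp M F (\<lambda>w. Z w $ i * Z w $ k) x) *v D x = 0"
  shows "AE x in M. Z x \<bullet> D x = 0"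
proof -
  have [measurable]: "D \<in> borel_measurable M"
    by (rule measurable_from_subalg[OF subalg D])
  have coord: "\<bar>D x $ i\<bar> \<le> 1" for x i
    using component_le_norm_cart[of "D x" i] bound[of x] by linarith
  have "integrable M (\<lambda>x. (D x $ i * D x $ k) * (Z x $ i * Z x $ k))" for i k
  proof (rule Bochner_Integration.integrable_bound[OF int[of i k]])
    have "\<bar>D x $ i\<bar> * \<bar>D x $ k\<bar> \<le> 1" for x
      by (intro mult_le_one coord) auto
    then show "AE x in M. norm ((D x $ i * D x $ k) * (Z x $ i * Z x $ k)) \<le> norm (Z x $ i * Z x $ k)"
      by (auto simp: abs_mult intro!: mult_left_le_one_le)
  qed measurable
  note intg = this real_cond_exp_intg[OF this]
  have expand: "(Z x \<bullet> D x)\<^sup>2 = (\<Sum>i\<in>UNIV. \<Sum>k\<in>UNIV. (D x $ i * D x $ k) * (Z x $ i * Z x $ k))" for x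
    by (simp add: inner_vec_def power2_eq_square sum_product mult_ac)
  have "(\<integral>x. (Z x \<bullet> D x)\<^sup>2 \<partial>M)
      = (\<Sum>i\<in>UNIV. \<Sum>k\<in>UNIV. \<integral>x. (D x $ i * D x $ k) * real_cond_exp M F (\<lambda>w. Z w $ i * Z w $ k) x \<partial>M)"
    unfolding expand by (simp add: intg)
  also have "\<dots> = (\<integral>x. D x \<bullet> ((\<chi> i k. real_cond_exp M F (\<lambda>w. Z w $ i * Z w $ k) x) *v D x) \<partial>M)"
    using intg(2)
    by (simp add: inner_vec_def matrix_vector_mult_def sum_distrib_left mult_ac)
  also have "\<dots> = 0"
    using kernel by (intro integral_eq_zero_AE) auto
  finally have "(\<integral>x. (Z x \<bullet> D x)\<^sup>2 \<partial>M) = 0" .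
  moreover have "integrable M (\<lambda>x. (Z x \<bullet> D x)\<^sup>2)"
    unfolding expand by (intro Bochner_Integration.integrable_sum intg)
  ultimately show ?thesis
    by (simp add: integral_nonneg_eq_0_iff_AE)
qed

end

lemma AE_inner_eq_0_imp_second_moment_kernel:
  fixes Z :: "'a \<Rightarrow> real ^ 'j"
  assumes int: "integrable M (\<lambda>x. outer_prod (Z x) (Z x))"
    and zero: "AE x in M. Z x \<bullet> d = 0"
  shows "(\<integral>x. outer_prod (Z x) (Z x) \<partial>M) *v d = 0"
proof -
  have lin: "bounded_linear (\<lambda>A :: real ^ 'j ^ 'j. A *v d)"
    by (simp add: linear_conv_bounded_linear[symmetric] linear_iff
        matrix_vector_mult_add_rdistrib scaleR_matrix_vector_assoc)
  have outer: "outer_prod z z *v d = (z \<bullet> d) *\<^sub>R z" for z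
    by (simp add: outer_prod_def matrix_vector_mult_def vec_eq_iff inner_vec_def
        sum_distrib_left mult_ac)
  have "(\<integral>x. outer_prod (Z x) (Z x) \<partial>M) *v d = (\<integral>x. (Z x \<bullet> d) *\<^sub>R Z x \<partial>M)"
    using integral_bounded_linear[OF lin int] by (simp add: outer)
  also have "\<dots> = 0"
    using zero by (intro integral_eq_zero_AE) auto
  finally show ?thesis .
qed

subsection \<open>Non-identification\<close>

theorem theorem4:
  fixes M :: "'w measure"
    and MX :: "'x measure" and MV :: "'v measure"
    and X :: "'w \<Rightarrow> 'x" and V :: "'w \<Rightarrow> 'v"
    and eps :: "'w \<Rightarrow> 'e::euclidean_space"
    and Y :: "'w \<Rightarrow> real" and g :: "'x \<Rightarrow> 'e \<Rightarrow> real"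
    and p :: "'x \<Rightarrow> real ^ 'j" and q0 :: "'v \<Rightarrow> real ^ 'j"
  assumes "prob_space M"
    and "X \<in> measurable M MX" and "V \<in> measurable M MV" and "eps \<in> borel_measurable M"
    and "(\<lambda>(x, e). g x e) \<in> borel_measurable (MX \<Otimes>\<^sub>M borel)"
    and "p \<in> borel_measurable MX" and "q0 \<in> borel_measurable MV"
    and "integrable M Y"
    and "integrable M (\<lambda>\<omega>. q0 (V \<omega>))"
    and "integrable M (\<lambda>\<omega>. outer_prod (p (X \<omega>)) (p (X \<omega>)))"
    and "AE \<omega> in M. integrable (distr M borel eps) (g (X \<omega>))"
    and "AE \<omega> in M. Y \<omega> = g (X \<omega>) (eps \<omega>)"
    and "control_variable M X MX eps borel V MV"
    and "AE \<omega> in M. cond_expect M Y (\<lambda>w. (X w, V w)) (MX \<Otimes>\<^sub>M MV) \<omega> = p (X \<omega>) \<bullet> q0 (V \<omega>)"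
    and "AE \<omega> in M. asf M g eps (X \<omega>) = p (X \<omega>) \<bullet> (\<integral>w. q0 (V w) \<partial>M)"
    and "invertible (\<integral>\<omega>. outer_prod (p (X \<omega>)) (p (X \<omega>)) \<partial>M)"
    and "measure M {\<omega> \<in> space M.
           \<not> invertible (cond_expect_matrix M (\<lambda>w. outer_prod (p (X w)) (p (X w))) V MV \<omega>)} > 0"
  shows "\<not> asf_identified M X V MV p q0"
proof -
  interpret prob_space M by fact
  note [measurable] = assms(2,3,6,7)
  note int_q0 = assms(9) and int_pp = assms(10) and inv = assms(16) and singular = assms(17)
  define F where "F = sigma_gen M V MV"
  define Z where "Z \<omega> = p (X \<omega>)" for \<omega>
  have [measurable]: "Z \<in> borel_measurable M"
    unfolding Z_def by measurable
  have V_space: "V \<in> space M \<rightarrow> space MV"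
    using assms(3) by (rule measurable_space[THEN funcsetI])
  have V_F [measurable]: "V \<in> measurable F MV"
    unfolding F_def sigma_gen_def by (rule measurable_vimage_algebra1[OF V_space])
  have "subalgebra M F"
    using assms(3) V_space
    by (auto simp: subalgebra_def F_def sigma_gen_def sets_vimage_algebra2 measurable_sets)
  then interpret finite_measure_subalgebra M F
    by unfold_locales
  have int_Z: "integrable M (\<lambda>\<omega>. Z \<omega> $ i * Z \<omega> $ k)" for i k
    using integrable_vec_nth[OF integrable_vec_nth[OF int_pp], of k i]
    by (simp add: outer_prod_def Z_def mult.commute)

  let ?C = "\<lambda>\<omega>. \<chi> i k. real_cond_exp M F (\<lambda>w. Z w $ i * Z w $ k) \<omega>"
  have C_eq: "cond_expect_matrix M (\<lambda>w. outer_prod (p (X w)) (p (X w))) V MV \<omega> = ?C \<omega>" for \<omega>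
    by (simp add: cond_expect_matrix_def cond_expect_def outer_prod_def Z_def F_def)
  \<comment> \<open>The perturbation of \<open>q0\<close> must be a function of \<open>V\<close>, so
    the conditional moments are first written as such functions.\<close>
  have "\<exists>h\<in>borel_measurable MV. \<forall>\<omega>\<in>space M. real_cond_exp M F (\<lambda>w. Z w $ i * Z w $ k) \<omega> = h (V \<omega>)" for i k
    using Doob_Dynkin_real[OF V_space] borel_measurable_cond_exp[of M F]
    unfolding F_def sigma_gen_def by blast
  then obtain a where [measurable]: "\<And>i k. a i k \<in> borel_measurable MV"
    and a: "\<And>i k \<omega>. \<omega> \<in> space M \<Longrightarrow> real_cond_exp M F (\<lambda>w. Z w $ i * Z w $ k) \<omega> = a i k (V \<omega>)"
    by metis
  define A where "A v = (\<chi> i k. a i k v)" for v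
  have [measurable]: "A \<in> borel_measurable MV"
    unfolding A_def by (intro borel_measurable_vec_lambda) measurable
  have A_V: "A (V \<omega>) = ?C \<omega>" if "\<omega> \<in> space M" for \<omega>
    using a[OF that] by (simp add: A_def)

  define D where "D i v = kernel_projection (A v) (axis i 1)" for i v
  have D_meas [measurable]: "D i \<in> borel_measurable MV" for i
    unfolding D_def by measurable
  have D_bound: "norm (D i v) \<le> 1" for i v
    unfolding D_def using norm_kernel_projection_le[of "A v" "axis i 1"] by simp
  have D_coord: "\<bar>D i v $ k\<bar> \<le> 1" for i k v
    using component_le_norm_cart[of "D i v" k] D_bound[of i v] by linarith
  have Z_D: "AE \<omega> in M. Z \<omega> \<bullet> D i (V \<omega>) = 0" for i
  proof (rule AE_inner_eq_0_of_cond_exp_kernel[OF _ _ D_bound int_Z])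
    show "AE \<omega> in M. ?C \<omega> *v D i (V \<omega>) = 0"
      by (rule AE_I2) (simp add: A_V[symmetric] D_def kernel_projection_in_kernel)
  qed measurable

  \<comment> \<open>The factor \<open>D i v $ k\<close> makes the \<open>k\<close>-th coordinate a square, so that its mean vanishes
    only if \<open>D i (V \<omega>) $ k\<close> vanishes almost surely.\<close>
  define \<Delta> where "\<Delta> i k v = (D i v $ k) *\<^sub>R D i v" for i k v
  have [measurable]: "\<Delta> i k \<in> borel_measurable MV" for i k
    unfolding \<Delta>_def by measurable
  have int_\<Delta>: "integrable M (\<lambda>\<omega>. \<Delta> i k (V \<omega>))" for i k
  proof (rule integrable_const_bound[where B = 1])
    show "AE \<omega> in M. norm (\<Delta> i k (V \<omega>)) \<le> 1"
      unfolding \<Delta>_def using mult_le_one[OF D_coord norm_ge_zero D_bound] by simp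
  qed measurable
  \<comment> \<open>Otherwise all projected unit vectors vanish almost surely, which makes the
    conditional matrix almost surely invertible.\<close>
  have "\<exists>i k. (\<integral>\<omega>. \<Delta> i k (V \<omega>) \<partial>M) \<noteq> 0"
  proof (rule ccontr)
    assume "\<nexists>i k. (\<integral>\<omega>. \<Delta> i k (V \<omega>) \<partial>M) \<noteq> 0"
    then have "(\<integral>\<omega>. \<Delta> i k (V \<omega>) $ k \<partial>M) = 0" for i k
      using vec_nth_integral[OF int_\<Delta>, of i k k] by simp
    then have "AE \<omega> in M. D i (V \<omega>) $ k = 0" for i k
      using integral_nonneg_eq_0_iff_AE[OF integrable_vec_nth[OF int_\<Delta>, of i k k]]
      by (simp add: \<Delta>_def)
    then have "AE \<omega> in M. \<forall>i k. D i (V \<omega>) $ k = 0"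
      by (simp add: AE_all_countable)
    with AE_space have "AE \<omega> in M. invertible (?C \<omega>)"
    proof eventually_elim
      case (elim \<omega>)
      then have "invertible (A (V \<omega>))"
        by (intro kernel_projection_axis_eq_0_imp_invertible) (simp add: D_def vec_eq_iff)
      with elim show ?case
        by (simp add: A_V)
    qed
    then obtain N where "{\<omega> \<in> space M. \<not> invertible (?C \<omega>)} \<subseteq> N" "emeasure M N = 0" "N \<in> events"
      by (rule AE_E)
    \<comment> \<open>Monotonicity asks for measurability of the larger set \<open>N\<close>
      only.\<close>
    then have "emeasure M {\<omega> \<in> space M. \<not> invertible (?C \<omega>)} = 0"
      using emeasure_mono[of _ N M] by fastforce
    then have "prob {\<omega> \<in> space M. \<not> invertible (?C \<omega>)} = 0"
      by (simp add: measure_def)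
    then show False
      using singular by (simp add: C_eq)
  qed
  then obtain i k where d: "(\<integral>\<omega>. \<Delta> i k (V \<omega>) \<partial>M) \<noteq> 0"
    by blast
  define d where "d = (\<integral>\<omega>. \<Delta> i k (V \<omega>) \<partial>M)"
  define q where "q v = q0 v + \<Delta> i k v" for v
  have E_q: "(\<integral>\<omega>. q (V \<omega>) \<partial>M) = (\<integral>\<omega>. q0 (V \<omega>) \<partial>M) + d"
    unfolding q_def d_def by (rule Bochner_Integration.integral_add[OF int_q0 int_\<Delta>])
  \<comment> \<open>Here nonsingularity of the unconditional second moment matrix enters: it turns
    \<open>d \<noteq> 0\<close> into a difference of the ASFs on a set of positive
    probability.\<close>
  have "\<not> (AE \<omega> in M. Z \<omega> \<bullet> d = 0)"
  proof
    assume "AE \<omega> in M. Z \<omega> \<bullet> d = 0"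
    then have "(\<integral>\<omega>. outer_prod (p (X \<omega>)) (p (X \<omega>)) \<partial>M) *v d = 0"
      using AE_inner_eq_0_imp_second_moment_kernel[OF int_pp] by (simp add: Z_def)
    then have "d = 0"
      using inv by (simp add: invertible_left_inverse matrix_left_invertible_ker)
    with d show False
      by (simp add: d_def)
  qed
  moreover have "{\<omega> \<in> space M. Z \<omega> \<bullet> d \<noteq> 0} \<in> events"
    by (intro borel_measurable_neq borel_measurable_inner) measurable
  ultimately have "prob {\<omega> \<in> space M. Z \<omega> \<bullet> d \<noteq> 0} \<noteq> 0"
    by (simp add: prob_eq_0)
  then have "prob {\<omega> \<in> space M. p (X \<omega>) \<bullet> (\<integral>w. q (V w) \<partial>M) \<noteq> p (X \<omega>) \<bullet> (\<integral>w. q0 (V w) \<partial>M)} > 0"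
    by (simp add: E_q inner_add_right Z_def zero_less_measure_iff)
  \<comment> \<open>The perturbation is a scalar multiple of \<open>D i\<close>, so it stays
    orthogonal to \<open>Z\<close> almost surely.\<close>
  moreover have "observationally_equivalent M X V p q q0"
    unfolding observationally_equivalent_def
    using Z_D[of i] by eventually_elim (simp add: q_def \<Delta>_def Z_def inner_add_right)
  moreover have "q \<in> borel_measurable MV"
    unfolding q_def by measurable
  moreover have "integrable M (\<lambda>\<omega>. q (V \<omega>))"
    unfolding q_def by (rule Bochner_Integration.integrable_add[OF int_q0 int_\<Delta>])
  ultimately show ?thesis
    unfolding asf_identified_def by blast
qed

end
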